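(* Let $n \geq 3$ be an integer and let $G$ be the $n\times n$ grid. Then the triangulated grid $Gt$ of $G$ satisfies $\chi''_{\mathcal{D}_1,\mathcal{D}_1}(Gt) = 4$.
   Context: All graphs are finite, simple, loopless and undirected. $\mathcal{D}_1$ denotes the class of all forests (acyclic graphs). A $(\mathcal{D}_1,\mathcal{D}_1)$-total colouring of a graph $G$ is a colouring of the vertices and edges of $G$ such that for each colour $i$, the vertices coloured $i$ induce a subgraph of $G$ that is a forest, the edges coloured $i$ induce a subgraph of $G$ that is a forest, and every edge receives a colour different from the colours of its two end vertices. (Adjacent vertices may share a colour, and so may adjacent edges.) $\chi''_{\mathcal{D}_1,\mathcal{D}_1}(G)$ is the minimum number of colours in such a colouring of $G$. The $n\times n$ grid is the cartesian product of two paths of order $n$; its vertices are $v_{ij}$, $1\le i,j\le n$ ($i$ the row, $j$ the column), with $v_{ij}$ adjacent to $v_{(i+1)j}$ and to $v_{i(j+1)}$ whenever these exist. The triangulated grid $Gt$ is obtained from the $n \times n$ grid $G$ by adding all diagonal edges $v_{ij}v_{(i+1)(j-1)}$ for $1\le i\le n-1$, $2\le j\le n$, and adding an edge between $v_{11}$ and every other vertex $v_{ij}$ on the outer face of the grid (i.e. with $i\in\{1,n\}$ or $j\in\{1,n\}$) not already adjacent to $v_{11}$. *)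

theory Defs
  imports Main
begin

(* A graph is a pair of a vertex set and an edge set; an edge is the set of its two end vertices. *)
type_synonym 'a graph = "'a set \<times> 'a set set"

abbreviation verts :: "'a graph \<Rightarrow> 'a set" where
  "verts G \<equiv> fst G"

abbreviation edges :: "'a graph \<Rightarrow> 'a set set" where
  "edges G \<equiv> snd G"

definition finite_simple_graph :: "'a graph \<Rightarrow> bool" where
  "finite_simple_graph G \<longleftrightarrow>
     finite (verts G) \<and> (\<forall>e\<in>edges G. e \<subseteq> verts G \<and> card e = 2)"

definition is_cycle :: "'a graph \<Rightarrow> 'a list \<Rightarrow> bool" where
  "is_cycle G p \<longleftrightarrow> 3 \<le> length p \<and> distinct p \<and> set p \<subseteq> verts G \<and>
     (\<forall>i<length p. {p ! i, p ! (Suc i mod length p)} \<in> edges G)"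

definition is_forest :: "'a graph \<Rightarrow> bool" where
  "is_forest G \<longleftrightarrow> (\<nexists>p. is_cycle G p)"

definition vertex_induced :: "'a graph \<Rightarrow> 'a set \<Rightarrow> 'a graph" where
  "vertex_induced G W = (W, {e \<in> edges G. e \<subseteq> W})"

definition edge_induced :: "'a set set \<Rightarrow> 'a graph" where
  "edge_induced F = (\<Union>F, F)"

(* f colours the vertices and g the edges, both from the same k colours {..<k}.  Neither needs to be
   proper, and a colour may be unused: the empty graph is a forest. *)
definition forest_total_colouring ::
  "'a graph \<Rightarrow> nat \<Rightarrow> ('a \<Rightarrow> nat) \<Rightarrow> ('a set \<Rightarrow> nat) \<Rightarrow> bool" where
  "forest_total_colouring G k f g \<longleftrightarrow>
     (\<forall>v\<in>verts G. f v < k) \<and> (\<forall>e\<in>edges G. g e < k) \<and>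
     (\<forall>i<k. is_forest (vertex_induced G {v \<in> verts G. f v = i})) \<and>
     (\<forall>i<k. is_forest (edge_induced {e \<in> edges G. g e = i})) \<and>
     (\<forall>e\<in>edges G. \<forall>v\<in>e. g e \<noteq> f v)"

(* The least number is well defined for every finite simple graph:
   see forest_total_colouring_exists below. *)
definition forest_total_chromatic_number :: "'a graph \<Rightarrow> nat" where
  "forest_total_chromatic_number G = (LEAST k. \<exists>f g. forest_total_colouring G k f g)"

(* (i, j) stands for the vertex in row i and column j. *)
definition grid :: "nat \<Rightarrow> (nat \<times> nat) graph" where
  "grid n = ({1..n} \<times> {1..n},
     {{(i, j), (i + 1, j)} | i j. 1 \<le> i \<and> i + 1 \<le> n \<and> 1 \<le> j \<and> j \<le> n} \<union>
     {{(i, j), (i, j + 1)} | i j. 1 \<le> i \<and> i \<le> n \<and> 1 \<le> j \<and> j + 1 \<le> n})"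

definition grid_diagonals :: "nat \<Rightarrow> (nat \<times> nat) set set" where
  "grid_diagonals n =
     {{(i, j), (i + 1, j - 1)} | i j. 1 \<le> i \<and> i \<le> n - 1 \<and> 2 \<le> j \<and> j \<le> n}"

definition grid_outer :: "nat \<Rightarrow> (nat \<times> nat) set" where
  "grid_outer n = {(i, j) \<in> verts (grid n). i \<in> {1, n} \<or> j \<in> {1, n}}"

(* Edges from (1, 1) to vertices that are already adjacent to it are absorbed by the union. *)
definition triangulated_grid :: "nat \<Rightarrow> (nat \<times> nat) graph" where
  "triangulated_grid n = (verts (grid n),
     edges (grid n) \<union> grid_diagonals n \<union> {{(1, 1), v} | v. v \<in> grid_outer n - {(1, 1)}})"

lemma finite_simple_graph_triangulated_grid:
  assumes "n \<ge> 1"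
  shows "finite_simple_graph (triangulated_grid n)"
  using assms
  by (auto simp: finite_simple_graph_def triangulated_grid_def grid_def grid_diagonals_def
      grid_outer_def card_insert_if)

lemma forest_total_colouring_exists:
  assumes "finite_simple_graph G"
  shows "\<exists>k f g. forest_total_colouring G k f g"
proof -
  have fV: "finite (verts G)" and E: "\<And>e. e \<in> edges G \<Longrightarrow> e \<subseteq> verts G \<and> card e = 2"
    using assms by (auto simp: finite_simple_graph_def)
  have fE: "finite (edges G)"
    by (rule finite_subset[of _ "Pow (verts G)"]) (use fV E in auto)
  obtain f :: "'a \<Rightarrow> nat" and m where f: "f ` verts G = {i. i < m}" "inj_on f (verts G)"
    using finite_imp_inj_to_nat_seg[OF fV] by blast
  obtain g :: "'a set \<Rightarrow> nat" and l where g: "g ` edges G = {i. i < l}" "inj_on g (edges G)"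
    using finite_imp_inj_to_nat_seg[OF fE] by blast
  have small: "is_forest H" if "finite (verts H) \<and> card (verts H) \<le> 2" for H :: "'a graph"
    unfolding is_forest_def
  proof
    assume "\<exists>p. is_cycle H p"
    then obtain p where "3 \<le> length p" "distinct p" "set p \<subseteq> verts H"
      by (auto simp: is_cycle_def)
    then show False
      using that card_mono[of "verts H" "set p"] distinct_card[of p] by linarith
  qed
  have "is_forest (vertex_induced G {v \<in> verts G. f v = i})" for i
  proof (rule small)
    have "card {v \<in> verts G. f v = i} \<le> Suc 0"
      using f(2) fV by (subst card_le_Suc0_iff_eq) (auto simp: inj_on_def)
    then show "finite (verts (vertex_induced G {v \<in> verts G. f v = i})) \<and>
        card (verts (vertex_induced G {v \<in> verts G. f v = i})) \<le> 2"
      using fV by (simp add: vertex_induced_def)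
  qed
  moreover have "is_forest (edge_induced {e \<in> edges G. m + g e = i})" for i
  proof (rule small)
    have "{e \<in> edges G. m + g e = i} = {} \<or> (\<exists>e\<in>edges G. {e \<in> edges G. m + g e = i} = {e})"
    proof (cases "\<exists>e\<in>edges G. m + g e = i")
      case True
      then obtain e where "e \<in> edges G" "m + g e = i" by blast
      moreover have "e' = e" if "e' \<in> edges G" "m + g e' = i" for e'
        using inj_onD[OF g(2), of e' e] that calculation by simp
      ultimately have "{e \<in> edges G. m + g e = i} = {e}" by blast
      with \<open>e \<in> edges G\<close> show ?thesis by blast
    qed blast
    moreover have "finite e \<and> card e = 2" if "e \<in> edges G" for e
      using E[OF that] fV finite_subset by blast
    ultimately have "finite (\<Union>{e \<in> edges G. m + g e = i}) \<and>
        card (\<Union>{e \<in> edges G. m + g e = i}) \<le> 2"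
      by (elim disjE bexE; simp only:; simp)
    then show "finite (verts (edge_induced {e \<in> edges G. m + g e = i})) \<and>
        card (verts (edge_induced {e \<in> edges G. m + g e = i})) \<le> 2"
      by (simp add: edge_induced_def)
  qed
  moreover have "\<forall>v\<in>verts G. f v < m" "\<forall>e\<in>edges G. g e < l"
    using f(1) g(1) by auto
  ultimately have "forest_total_colouring G (m + l) f (\<lambda>e. m + g e)"
    using E unfolding forest_total_colouring_def
    by (metis nat_add_left_cancel_less not_add_less1 subsetD trans_less_add1)
  then show ?thesis by blast
qed

end

theory Submission
  imports Defs
begin

text \<open>
  \<^emph>\<open>Fewer than four colours do not suffice.\<close>  The edges of colour \<open>i\<close> avoid the set \<open>V\<^sub>i\<close> of vertices
  of colour \<open>i\<close>, so they form a forest on the \<open>|V| - |V\<^sub>i|\<close> other vertices and there are at most that many of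
  them.  Since the \<open>V\<^sub>i\<close> partition \<open>V\<close>, summing over \<open>k\<close> colours gives \<open>|E| \<le> (k - 1)|V|\<close>
  (\<open>card_edges_le_of_forest_total_colouring\<close>).  The triangulated grid is a plane triangulation, and already
  a part of its \<open>3n\<^sup>2 - 6\<close> edges exceeds \<open>2n\<^sup>2 = 2|V|\<close> (\<open>card_edges_triangulated_grid\<close>), so \<open>k \<ge> 4\<close>.

  \<^emph>\<open>Four colours suffice.\<close>  The corner \<open>(1, 1)\<close> has colour 3 to itself and the other vertices have
  colour 0 or 1 according to the parity of their row.  Every colour class then induces a union of
  disjoint horizontal paths.  The edges are covered by three trees, each given by a parent function:
  \<^item> the columns, joined at the top by spokes to the corner; in the first column every vertex hangs
    directly on the corner.  No vertex has colour 2, so this tree can be coloured 2.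
  \<^item> the antidiagonals, joined along the first column (below the corner) and along the last row.
    This tree avoids the corner, so it can be coloured 3.
  \<^item> the rows, each joined to the corner at its right end; the last row, whose horizontal edges belong
    to the second tree, is joined to the corner by a star, and the first row contains the corner.  Every
    edge here stays in one row or ends in the corner, so one of the colours 0 and 1, namely the one that
    does not occur in this row, is available for it.

  Counting shows how little room there is: in a colouring with four colours the four edge forests
  have at most \<open>3n\<^sup>2 - 4\<close> edges altogether, two more than the graph.
\<close>

section \<open>Forests\<close>

lemma is_forest_subgraph:
  assumes "is_forest G" "verts H \<subseteq> verts G" "edges H \<subseteq> edges G"
  shows "is_forest H"
  using assms unfolding is_forest_def is_cycle_def by blast

text \<open>On a cycle, consider a vertex of greatest rank: the edges of the cycle at this vertex both lead
  to its parent, but its two neighbours on the cycle are distinct.\<close>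

lemma is_forest_if_parent:
  fixes r :: "'a \<Rightarrow> nat" and p :: "'a \<Rightarrow> 'a"
  assumes parent: "\<And>e. e \<in> edges G \<Longrightarrow> \<exists>v. e = {v, p v} \<and> r (p v) < r v"
  shows "is_forest G"
  unfolding is_forest_def
proof
  assume "\<exists>c. is_cycle G c"
  then obtain c where len: "3 \<le> length c" and dist: "distinct c"
    and edge: "\<And>i. i < length c \<Longrightarrow> {c ! i, c ! (Suc i mod length c)} \<in> edges G"
    by (auto simp: is_cycle_def)
  let ?m = "length c"
  have "finite (set c)" "set c \<noteq> {}"
    using len by auto
  then obtain x where "x \<in> set c" and x_max: "\<And>y. y \<in> set c \<Longrightarrow> r y \<le> r x"
    using Max_in[of "r ` set c"] Max_ge[of "r ` set c"] by fastforce
  then obtain a where a: "a < ?m" "x = c ! a"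
    by (metis in_set_conv_nth)
  \<comment> \<open>the positions after and before \<open>a\<close>, cyclically; they differ since the cycle has length at least 3\<close>
  define s where "s = Suc a mod ?m"
  define b where "b = (if a = 0 then ?m - 1 else a - 1)"
  have b: "b < ?m" "Suc b mod ?m = a" and s: "s < ?m"
    using a len by (auto simp: b_def s_def intro: mod_less_divisor)
  have "s \<noteq> b"
    using a len by (auto simp: b_def s_def mod_Suc split: if_splits)
  have to_parent: "y = p x" if xy: "{x, y} \<in> edges G" "y \<in> set c" for y
  proof -
    obtain v where "{x, y} = {v, p v}" "r (p v) < r v"
      using parent[OF xy(1)] by blast
    then show ?thesis
      using x_max[OF xy(2)] by (auto simp: doubleton_eq_iff)
  qed
  have "c ! s = p x"
    using to_parent[of "c ! s"] edge[OF a(1)] a s by (simp add: s_def)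
  moreover have "c ! b = p x"
    using to_parent[of "c ! b"] edge[OF b(1)] a b by (simp add: insert_commute)
  ultimately show False
    using dist s b \<open>s \<noteq> b\<close> by (metis nth_eq_iff_index_eq)
qed

lemma finite_edges:
  assumes "finite_simple_graph G"
  shows "finite (edges G)"
  by (rule finite_subset[of _ "Pow (verts G)"]) (use assms in \<open>auto simp: finite_simple_graph_def\<close>)

text \<open>If every vertex had degree at least two, the first vertex of a longest path would have a
  neighbour other than its successor; by maximality this neighbour lies on the path and closes a
  cycle.\<close>

lemma forest_has_vertex_of_degree_le_1:
  assumes simple: "finite_simple_graph G" and forest: "is_forest G" and "verts G \<noteq> {}"
  shows "\<exists>v\<in>verts G. card {e \<in> edges G. v \<in> e} \<le> 1"
proof (rule ccontr)
  assume "\<not> ?thesis"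
  then have deg: "\<And>v. v \<in> verts G \<Longrightarrow> 2 \<le> card {e \<in> edges G. v \<in> e}"
    by force
  define path where "path q \<longleftrightarrow> distinct q \<and> set q \<subseteq> verts G \<and> q \<noteq> [] \<and>
    (\<forall>i. Suc i < length q \<longrightarrow> {q ! i, q ! Suc i} \<in> edges G)" for q
  have fin: "finite (verts G)"
    using simple by (simp add: finite_simple_graph_def)
  obtain v where "v \<in> verts G"
    using assms(3) by blast
  then have "path [v]"
    by (simp add: path_def)
  moreover have "length q \<le> card (verts G)" if "path q" for q
    using that fin by (metis path_def card_mono distinct_card)
  ultimately obtain q where q: "path q" and longest: "\<And>q'. path q' \<Longrightarrow> length q' \<le> length q"
    using ex_has_greatest_nat[of path "[v]" length "Suc (card (verts G))"]
    by (auto simp: less_Suc_eq_le)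
  define x where "x = q ! 0"
  have "x \<in> verts G"
    using q by (auto simp: path_def x_def)
  have "finite {e \<in> edges G. x \<in> e}"
    using finite_edges[OF simple] by simp
  then have "card ({e \<in> edges G. x \<in> e} - {{x, q ! 1}}) \<noteq> 0"
    using deg[OF \<open>x \<in> verts G\<close>] by (simp add: card_Diff_singleton_if)
  then have "{e \<in> edges G. x \<in> e} - {{x, q ! 1}} \<noteq> {}"
    by (metis card.empty)
  then obtain e where e: "e \<in> edges G" "x \<in> e" "e \<noteq> {x, q ! 1}"
    by blast
  have e2: "e \<subseteq> verts G" "card e = 2"
    using simple e(1) by (auto simp: finite_simple_graph_def)
  obtain y z' where yz': "e = {y, z'}" "y \<noteq> z'"
    using e2(2) by (auto simp: card_2_iff)
  obtain z where z: "e = {x, z}" "z \<noteq> x"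
  proof (cases "x = y")
    case True
    then show ?thesis using yz' that[of z'] by auto
  next
    case False
    then show ?thesis using yz' e(2) that[of y] by auto
  qed
  have "z \<in> verts G" "z \<noteq> q ! 1"
    using e2 e z by auto
  have "z \<in> set q"
  proof (rule ccontr)
    assume "z \<notin> set q"
    then have "path (z # q)"
      using q z e(1) \<open>z \<in> verts G\<close>
      by (auto simp: path_def nth_Cons x_def insert_commute split: nat.splits)
    then show False
      using longest by force
  qed
  then obtain k where k: "k < length q" "q ! k = z"
    by (metis in_set_conv_nth)
  have "k \<noteq> 0" "k \<noteq> 1"
    using k(2) z(2) \<open>z \<noteq> q ! 1\<close> unfolding x_def by metis+
  then have "2 \<le> k"
    by simp
  have "is_cycle G (take (Suc k) q)"
    unfolding is_cycle_def
  proof (intro conjI allI impI)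
    show "3 \<le> length (take (Suc k) q)"
      using k \<open>2 \<le> k\<close> by simp
    show "distinct (take (Suc k) q)" "set (take (Suc k) q) \<subseteq> verts G"
      using q set_take_subset[of "Suc k" q] by (auto simp: path_def)
  next
    fix i assume "i < length (take (Suc k) q)"
    then have "i < k \<or> i = k"
      by auto
    then show "{take (Suc k) q ! i, take (Suc k) q ! (Suc i mod length (take (Suc k) q))} \<in> edges G"
    proof
      assume "i < k"
      then show ?thesis
        using q k by (simp add: path_def)
    next
      assume "i = k"
      moreover have "length (take (Suc k) q) = Suc k"
        using k by simp
      ultimately show ?thesis
        using k z e(1) by (simp add: x_def insert_commute)
    qed
  qed
  then show False
    using forest by (auto simp: is_forest_def)
qed

lemma card_edges_forest_le:
  assumes "finite_simple_graph G" "is_forest G"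
  shows "card (edges G) \<le> card (verts G)"
  using assms
proof (induction "card (verts G)" arbitrary: G)
  case 0
  then have "verts G = {}"
    by (auto simp: finite_simple_graph_def)
  then have "edges G = {}"
    using 0 by (fastforce simp: finite_simple_graph_def)
  then show ?case
    by simp
next
  case (Suc m)
  then obtain v where v: "v \<in> verts G" "card {e \<in> edges G. v \<in> e} \<le> 1"
    using forest_has_vertex_of_degree_le_1[of G] by force
  define H where "H = (verts G - {v}, {e \<in> edges G. v \<notin> e})"
  have "finite_simple_graph H"
    using Suc.prems by (auto simp: finite_simple_graph_def H_def)
  moreover have "is_forest H"
    by (rule is_forest_subgraph[OF Suc.prems(2)]) (auto simp: H_def)
  moreover have m: "m = card (verts H)"
    using Suc v by (simp add: H_def)
  ultimately have "card (edges H) \<le> m"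
    using Suc.hyps(1)[of H] by simp
  moreover have "card (edges G) \<le> card (edges H) + card {e \<in> edges G. v \<in> e}"
  proof -
    have "edges G = edges H \<union> {e \<in> edges G. v \<in> e}"
      by (auto simp: H_def)
    then show ?thesis
      using card_Un_le[of "edges H" "{e \<in> edges G. v \<in> e}"] by metis
  qed
  ultimately show ?case
    using v Suc.hyps(2) by simp
qed

section \<open>At least four colours\<close>

lemma card_eq_sum_card_fibres:
  assumes "finite A" "\<And>x. x \<in> A \<Longrightarrow> h x < (k::nat)"
  shows "card A = (\<Sum>i<k. card {x \<in> A. h x = i})"
proof -
  have "h ` A \<subseteq> {..<k}"
    using assms(2) by auto
  then show ?thesis
    using sum.group[of A "{..<k}" h "\<lambda>_. 1::nat"] assms(1) by simp
qed

lemma card_edges_le_of_forest_total_colouring: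
  assumes simple: "finite_simple_graph G" and col: "forest_total_colouring G k f g"
  shows "card (edges G) + card (verts G) \<le> k * card (verts G)"
proof -
  let ?V = "\<lambda>i. {v \<in> verts G. f v = i}" and ?E = "\<lambda>i. {e \<in> edges G. g e = i}"
  have fin: "finite (verts G)"
    using simple by (simp add: finite_simple_graph_def)
  have "card (?E i) + card (?V i) \<le> card (verts G)" if "i < k" for i
  proof -
    have sub: "\<Union>(?E i) \<subseteq> verts G - ?V i"
      using simple col by (fastforce simp: finite_simple_graph_def forest_total_colouring_def)
    have "finite_simple_graph (edge_induced (?E i))"
      using simple finite_subset[OF sub] fin by (auto simp: finite_simple_graph_def edge_induced_def)
    moreover have "is_forest (edge_induced (?E i))"
      using col that by (simp add: forest_total_colouring_def)
    ultimately have "card (?E i) \<le> card (\<Union>(?E i))"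
      using card_edges_forest_le by (force simp: edge_induced_def)
    also have "\<dots> \<le> card (verts G - ?V i)"
      using card_mono[OF _ sub] fin by simp
    finally show ?thesis
      using card_Diff_subset[of "?V i" "verts G"] card_mono[of "verts G" "?V i"] fin by simp
  qed
  then have "(\<Sum>i<k. card (?E i) + card (?V i)) \<le> (\<Sum>i<k. card (verts G))"
    by (intro sum_mono) simp
  moreover have "card (edges G) = (\<Sum>i<k. card (?E i))"
    using col finite_edges[OF simple]
    by (intro card_eq_sum_card_fibres) (auto simp: forest_total_colouring_def)
  moreover have "card (verts G) = (\<Sum>i<k. card (?V i))"
    using col fin by (intro card_eq_sum_card_fibres) (auto simp: forest_total_colouring_def)
  ultimately show ?thesis
    by (simp add: sum.distrib)
qed

text \<open>It is enough to count the grid edges, the antidiagonal edges, and the spokes from the corner to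
  the last row and the last column: these are \<open>2n(n - 1) + (n - 1)\<^sup>2 + 2n - 1 = 3n\<^sup>2 - 2n\<close> edges.\<close>

lemma card_edges_triangulated_grid:
  assumes "n \<ge> 3"
  shows "2 * n\<^sup>2 < card (edges (triangulated_grid n))"
proof -
  obtain m where n: "n = Suc m" and m: "2 \<le> m"
    using assms by (cases n) auto
  define A where "A = (\<lambda>(i, j). {(i, j), (i + 1, j)}) ` ({1..m} \<times> {1..n})"
  define B where "B = (\<lambda>(i, j). {(i, j), (i, j + 1)}) ` ({1..n} \<times> {1..m})"
  define C where "C = (\<lambda>(i, j). {(i, j + 1), (i + 1, j)}) ` ({1..m} \<times> {1..m})"
  define S where "S = (\<lambda>v. {(1, 1), v}) ` ({n} \<times> {1..n} \<union> {1..m} \<times> {n})"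
  have fin: "finite A" "finite B" "finite C" "finite S"
    by (auto simp: A_def B_def C_def S_def)
  have "card A = m * n"
    unfolding A_def by (subst card_image) (auto simp: inj_on_def doubleton_eq_iff)
  moreover have "card B = n * m"
    unfolding B_def by (subst card_image) (auto simp: inj_on_def doubleton_eq_iff)
  moreover have "card C = m * m"
    unfolding C_def by (subst card_image) (auto simp: inj_on_def doubleton_eq_iff)
  moreover have "card S = n + m"
  proof -
    have "card S = card ({n} \<times> {1..n} \<union> {1..m} \<times> {n})"
      unfolding S_def by (subst card_image) (auto simp: inj_on_def doubleton_eq_iff)
    also have "\<dots> = n + m"
      by (subst card_Un_disjoint) (auto simp: n)
    finally show ?thesis .
  qed
  moreover have "A \<inter> B = {}"
    by (auto simp: A_def B_def doubleton_eq_iff)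
  moreover have "(A \<union> B) \<inter> C = {}"
  proof -
    \<comment> \<open>the coordinate sum is constant along antidiagonals only\<close>
    have "card ((\<lambda>(i, j). i + j) ` e) = 1" if "e \<in> C" for e
      using that by (auto simp: C_def)
    moreover have "card ((\<lambda>(i, j). i + j) ` e) = 2" if "e \<in> A \<union> B" for e
      using that by (auto simp: A_def B_def)
    ultimately show ?thesis
      by force
  qed
  moreover have "(A \<union> B \<union> C) \<inter> S = {}"
  proof -
    \<comment> \<open>the counted spokes end at vertices that are not grid neighbours of the corner, since \<open>n \<ge> 3\<close>\<close>
    have "(1, 1) \<in> e" "(2, 1) \<notin> e" "(1, 2) \<notin> e" if "e \<in> S" for e
      using that m by (auto simp: S_def n)
    moreover have "(2, 1) \<in> e" if "e \<in> A" "(1, 1) \<in> e" for e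
      using that by (auto simp: A_def)
    moreover have "(1, 2) \<in> e" if "e \<in> B" "(1, 1) \<in> e" for e
      using that by (auto simp: B_def)
    moreover have "(1, 1) \<notin> e" if "e \<in> C" for e
      using that by (auto simp: C_def)
    ultimately show ?thesis
      by blast
  qed
  ultimately have "card (A \<union> B \<union> C \<union> S) = m * n + n * m + m * m + (n + m)"
    using fin by (simp add: card_Un_disjoint)
  moreover have "A \<union> B \<union> C \<union> S \<subseteq> edges (triangulated_grid n)"
  proof -
    have "A \<subseteq> edges (grid n)"
      unfolding A_def grid_def n by fastforce
    moreover have "B \<subseteq> edges (grid n)"
      unfolding B_def grid_def n by fastforce
    moreover have "C \<subseteq> grid_diagonals n"
      unfolding C_def grid_diagonals_def n by fastforce
    moreover have "S \<subseteq> {{(1, 1), v} | v. v \<in> grid_outer n - {(1, 1)}}"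
      using m by (force simp: S_def grid_outer_def grid_def n)
    ultimately show ?thesis
      by (auto simp: triangulated_grid_def)
  qed
  then have "card (A \<union> B \<union> C \<union> S) \<le> card (edges (triangulated_grid n))"
    using assms by (intro card_mono finite_edges finite_simple_graph_triangulated_grid) auto
  moreover have "2 * 2 \<le> m * m"
    using m by (intro mult_mono) auto
  ultimately show ?thesis
    by (simp add: n power2_eq_square algebra_simps)
qed

section \<open>Four colours\<close>

definition vertex_colour :: "nat \<times> nat \<Rightarrow> nat" where
  "vertex_colour v = (if v = (1, 1) then 3 else if odd (fst v) then 0 else 1)"

fun row_parent :: "nat \<Rightarrow> nat \<times> nat \<Rightarrow> nat \<times> nat" where
  "row_parent n (i, j) =
     (if i = 1 then (1, j - 1) else if i = n \<or> j = n then (1, 1) else (i, j + 1))"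

fun column_parent :: "nat \<times> nat \<Rightarrow> nat \<times> nat" where
  "column_parent (i, j) = (if i = 1 \<or> j = 1 then (1, 1) else (i - 1, j))"

fun antidiagonal_parent :: "nat \<Rightarrow> nat \<times> nat \<Rightarrow> nat \<times> nat" where
  "antidiagonal_parent n (i, j) =
     (if i = n then (n, j - 1) else if j = 1 then (i + 1, 1) else (i + 1, j - 1))"

definition parent_edges :: "('a \<Rightarrow> 'a) \<Rightarrow> 'a set \<Rightarrow> 'a set set" where
  "parent_edges p W = {{v, p v} | v. v \<in> W}"

abbreviation row_tree :: "nat \<Rightarrow> (nat \<times> nat) set set" where
  "row_tree n \<equiv> parent_edges (row_parent n) ({1..n} \<times> {1..n} - {(1, 1)})"

abbreviation column_tree :: "nat \<Rightarrow> (nat \<times> nat) set set" where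
  "column_tree n \<equiv> parent_edges column_parent ({1..n} \<times> {1..n} - {(1, 1)})"

abbreviation antidiagonal_tree :: "nat \<Rightarrow> (nat \<times> nat) set set" where
  "antidiagonal_tree n \<equiv>
     parent_edges (antidiagonal_parent n) ({1..n} \<times> {1..n} - {(1, 1), (n, 1)})"

text \<open>The trees overlap (for instance in the spoke to \<open>(n, 1)\<close>), so the case distinction also
  decides which tree receives a shared edge.  An edge of the row tree gets whichever of the colours
  0 and 1 its ends do not have.\<close>

definition edge_colour :: "nat \<Rightarrow> (nat \<times> nat) set \<Rightarrow> nat" where
  "edge_colour n e =
     (if e \<in> antidiagonal_tree n then 3 else if e \<in> column_tree n then 2
      else if \<exists>v\<in>e. vertex_colour v = 0 then 1 else 0)"

lemma edges_triangulated_grid_cases: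
  assumes "e \<in> edges (triangulated_grid n)"
  obtains (vertical) i j where "e = {(i, j), (i + 1, j)}" "1 \<le> i" "i < n" "1 \<le> j" "j \<le> n"
  | (horizontal) i j where "e = {(i, j), (i, j + 1)}" "1 \<le> i" "i \<le> n" "1 \<le> j" "j < n"
  | (antidiagonal) i j where "e = {(i, j), (i + 1, j - 1)}" "1 \<le> i" "i < n" "2 \<le> j" "j \<le> n"
  | (spoke) i j where "e = {(1, 1), (i, j)}" "(i, j) \<noteq> (1, 1)"
      "1 \<le> i" "i \<le> n" "1 \<le> j" "j \<le> n" "i \<in> {1, n} \<or> j \<in> {1, n}"
proof -
  consider "e \<in> edges (grid n)" | "e \<in> grid_diagonals n"
    | "e \<in> {{(1, 1), v} | v. v \<in> grid_outer n - {(1, 1)}}"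
    using assms by (auto simp: triangulated_grid_def)
  then show ?thesis
  proof cases
    case 1
    then show ?thesis using vertical horizontal by (fastforce simp: grid_def)
  next
    case 2
    then show ?thesis using antidiagonal by (fastforce simp: grid_diagonals_def)
  next
    case 3
    then show ?thesis using spoke by (fastforce simp: grid_outer_def grid_def)
  qed
qed

lemma edges_covered_by_trees:
  assumes "n \<ge> 2" "e \<in> edges (triangulated_grid n)"
  shows "e \<in> row_tree n \<union> column_tree n \<union> antidiagonal_tree n"
proof -
  have row: "{v, w} \<in> row_tree n"
    if "row_parent n v = w" "v \<in> {1..n} \<times> {1..n}" "v \<noteq> (1, 1)" for v w
    using that unfolding parent_edges_def by blast
  have column: "{v, w} \<in> column_tree n"
    if "column_parent v = w" "v \<in> {1..n} \<times> {1..n}" "v \<noteq> (1, 1)" for v w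
    using that unfolding parent_edges_def by blast
  have anti: "{v, w} \<in> antidiagonal_tree n"
    if "antidiagonal_parent n v = w" "v \<in> {1..n} \<times> {1..n}" "v \<noteq> (1, 1)" "v \<noteq> (n, 1)" for v w
    using that unfolding parent_edges_def by blast
  from assms(2) show ?thesis
  proof (cases rule: edges_triangulated_grid_cases)
    case (vertical i j)
    show ?thesis
    proof (cases "i = 1 \<or> j \<noteq> 1")
      case True
      then have "{(i + 1, j), (i, j)} \<in> column_tree n"
        using vertical by (intro column) auto
      then show ?thesis using vertical by (simp add: insert_commute)
    next
      case False
      then have "{(i, j), (i + 1, j)} \<in> antidiagonal_tree n"
        using vertical by (intro anti) auto
      then show ?thesis using vertical by simp
    qed
  next
    case (horizontal i j)
    consider "i = n" | "i = 1" "i \<noteq> n" | "i \<noteq> 1" "i \<noteq> n"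
      by blast
    then show ?thesis
    proof cases
      case 1
      then have "{(i, j + 1), (i, j)} \<in> antidiagonal_tree n"
        using horizontal by (intro anti) auto
      then show ?thesis using horizontal by (simp add: insert_commute)
    next
      case 2
      then have "{(i, j + 1), (i, j)} \<in> row_tree n"
        using horizontal by (intro row) auto
      then show ?thesis using horizontal by (simp add: insert_commute)
    next
      case 3
      then have "{(i, j), (i, j + 1)} \<in> row_tree n"
        using horizontal by (intro row) auto
      then show ?thesis using horizontal by simp
    qed
  next
    case (antidiagonal i j)
    then have "{(i, j), (i + 1, j - 1)} \<in> antidiagonal_tree n"
      by (intro anti) auto
    then show ?thesis using antidiagonal by simp
  next
    case (spoke i j)
    show ?thesis
    proof (cases "i = 1 \<or> j = 1")
      case True
      then have "{(i, j), (1, 1)} \<in> column_tree n"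
        using spoke by (intro column) auto
      then show ?thesis using spoke by (simp add: insert_commute)
    next
      case False
      then have "{(i, j), (1, 1)} \<in> row_tree n"
        using spoke by (intro row) auto
      then show ?thesis using spoke by (simp add: insert_commute)
    qed
  qed
qed

lemma is_forest_parent_edges:
  fixes r :: "'a \<Rightarrow> nat"
  assumes "\<And>v. v \<in> W \<Longrightarrow> r (p v) < r v" "F \<subseteq> parent_edges p W"
  shows "is_forest (edge_induced F)"
proof (rule is_forest_if_parent)
  fix e assume "e \<in> edges (edge_induced F)"
  then obtain v where "v \<in> W" "e = {v, p v}"
    using assms(2) by (auto simp: edge_induced_def parent_edges_def)
  then show "\<exists>v. e = {v, p v} \<and> r (p v) < r v"
    using assms(1) by blast
qed

text \<open>The rank measures the distance from the left end in the first row, and from the corner past the right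
  end in the other rows.\<close>

lemma is_forest_row_tree:
  assumes "F \<subseteq> row_tree n"
  shows "is_forest (edge_induced F)"
  by (rule is_forest_parent_edges[where r = "\<lambda>(i, j). if i = 1 then j - 1 else n + 1 - j", OF _ assms])
    (auto split: if_splits)

lemma is_forest_column_tree:
  assumes "F \<subseteq> column_tree n"
  shows "is_forest (edge_induced F)"
  by (rule is_forest_parent_edges[where r = "\<lambda>(i, j). i + j", OF _ assms])
    (auto split: if_splits)

lemma is_forest_antidiagonal_tree:
  assumes "F \<subseteq> antidiagonal_tree n"
  shows "is_forest (edge_induced F)"
  by (rule is_forest_parent_edges[where r = "\<lambda>(i, j). n - i + j", OF _ assms])
    (auto split: if_splits)

text \<open>Edges that are not horizontal join rows of different parity or end in the corner, which is the
  only vertex of its colour.  So each class induces a subgraph of the rows, in which the left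
  neighbour serves as parent.\<close>

lemma is_forest_vertex_colour_class:
  "is_forest (vertex_induced (triangulated_grid n) {v \<in> verts (triangulated_grid n). vertex_colour v = c})"
proof (rule is_forest_if_parent[of _ "\<lambda>(i, j). (i, j - 1)" snd])
  fix e
  assume "e \<in> edges (vertex_induced (triangulated_grid n)
    {v \<in> verts (triangulated_grid n). vertex_colour v = c})"
  then have e: "e \<in> edges (triangulated_grid n)" and c: "\<And>v. v \<in> e \<Longrightarrow> vertex_colour v = c"
    by (auto simp: vertex_induced_def)
  from e show "\<exists>v. e = {v, (case v of (i, j) \<Rightarrow> (i, j - 1))} \<and>
    snd (case v of (i, j) \<Rightarrow> (i, j - 1)) < snd v"
  proof (cases rule: edges_triangulated_grid_cases)
    case (vertical i j)
    then show ?thesis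
      using c[of "(i, j)"] c[of "(i + 1, j)"] by (auto simp: vertex_colour_def split: if_splits)
  next
    case (horizontal i j)
    then show ?thesis
      by (intro exI[of _ "(i, j + 1)"]) auto
  next
    case (antidiagonal i j)
    then show ?thesis
      using c[of "(i, j)"] c[of "(i + 1, j - 1)"] by (auto simp: vertex_colour_def split: if_splits)
  next
    case (spoke i j)
    then show ?thesis
      using c[of "(1, 1)"] c[of "(i, j)"] by (auto simp: vertex_colour_def split: if_splits)
  qed
qed

lemma edge_colour_neq_vertex_colour:
  assumes n: "n \<ge> 2" and e: "e \<in> edges (triangulated_grid n)" and v: "v \<in> e"
  shows "edge_colour n e \<noteq> vertex_colour v"
proof -
  have v2: "vertex_colour v \<noteq> 2"
    by (simp add: vertex_colour_def)
  consider "e \<in> antidiagonal_tree n" | "e \<notin> antidiagonal_tree n" "e \<in> column_tree n"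
    | "e \<notin> antidiagonal_tree n" "e \<notin> column_tree n" "e \<in> row_tree n"
    using edges_covered_by_trees[OF n e] by blast
  then show ?thesis
  proof cases
    case 1
    then have "v \<noteq> (1, 1)"
      using v n by (auto simp: parent_edges_def split: if_splits)
    then show ?thesis
      using 1 by (simp add: edge_colour_def vertex_colour_def)
  next
    case 2
    then show ?thesis
      using v2 by (simp add: edge_colour_def)
  next
    case 3
    then obtain w where w: "e = {w, row_parent n w}"
      unfolding parent_edges_def by blast
    have "row_parent n w = (1, 1) \<or> fst (row_parent n w) = fst w"
      by (cases w) auto
    then have "vertex_colour (row_parent n w) \<in> {3, vertex_colour w} \<or> vertex_colour w = 3"
      by (auto simp: vertex_colour_def)
    then have "\<not> (\<exists>x\<in>e. \<exists>y\<in>e. vertex_colour x = 0 \<and> vertex_colour y = 1)"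
      unfolding w by auto
    then show ?thesis
      using 3 v by (auto simp: edge_colour_def)
  qed
qed

lemma forest_total_colouring_triangulated_grid:
  assumes n: "n \<ge> 2"
  shows "forest_total_colouring (triangulated_grid n) 4 vertex_colour (edge_colour n)"
  unfolding forest_total_colouring_def
proof (intro conjI ballI allI impI)
  fix c :: nat
  let ?F = "{e \<in> edges (triangulated_grid n). edge_colour n e = c}"
  have "?F \<subseteq> row_tree n \<or> ?F \<subseteq> column_tree n \<or> ?F \<subseteq> antidiagonal_tree n"
  proof -
    have "?F \<subseteq> antidiagonal_tree n" if "c = 3"
      using that by (auto simp: edge_colour_def split: if_splits)
    moreover have "?F \<subseteq> column_tree n" if "c = 2"
      using that by (auto simp: edge_colour_def split: if_splits)
    moreover have "?F \<subseteq> row_tree n" if "c \<noteq> 3" "c \<noteq> 2"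
      using that edges_covered_by_trees[OF n] by (auto simp: edge_colour_def split: if_splits)
    ultimately show ?thesis
      by blast
  qed
  then show "is_forest (edge_induced ?F)"
    using is_forest_row_tree is_forest_column_tree is_forest_antidiagonal_tree by blast
next
  fix e v
  assume "e \<in> edges (triangulated_grid n)" "v \<in> e"
  then show "edge_colour n e \<noteq> vertex_colour v"
    by (rule edge_colour_neq_vertex_colour[OF n])
next
  fix v show "vertex_colour v < 4"
    by (simp add: vertex_colour_def)
next
  fix e show "edge_colour n e < 4"
    by (simp add: edge_colour_def)
qed (rule is_forest_vertex_colour_class)

theorem theorem4p1:
  fixes n :: nat
  assumes "n \<ge> 3"
  shows "forest_total_chromatic_number (triangulated_grid n) = 4"
  unfolding forest_total_chromatic_number_def
proof (rule Least_equality)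
  show "\<exists>f g. forest_total_colouring (triangulated_grid n) 4 f g"
    using forest_total_colouring_triangulated_grid[of n] assms by auto
next
  fix k
  assume "\<exists>f g. forest_total_colouring (triangulated_grid n) k f g"
  then obtain f g where "forest_total_colouring (triangulated_grid n) k f g"
    by blast
  then have "card (edges (triangulated_grid n)) + card (verts (triangulated_grid n))
      \<le> k * card (verts (triangulated_grid n))"
    using finite_simple_graph_triangulated_grid[of n] assms
    by (intro card_edges_le_of_forest_total_colouring) auto
  moreover have "card (verts (triangulated_grid n)) = n\<^sup>2"
    by (simp add: triangulated_grid_def grid_def power2_eq_square)
  ultimately have "card (edges (triangulated_grid n)) + n\<^sup>2 \<le> k * n\<^sup>2"
    by simp
  then have "3 * n\<^sup>2 < k * n\<^sup>2"
    using card_edges_triangulated_grid[OF assms] by linarith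
  then have "3 < k"
    by (rule mult_less_cancel2[THEN iffD1, THEN conjunct2])
  then show "4 \<le> k"
    by simp
qed

end
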